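(* For every positive integer $n$ and each choice $\mathsf{stat}\in\{\mathsf{cyc},\mathsf{inv}\}$, there are polynomials $b_{n,i}^{+}(q)$ and $b_{n,i}^{-}(q)$ with positive integral coefficients such that $$\sum_{\pi\in\mathfrak{SD}_n^{+}}q^{\mathsf{stat}(\pi)}t^{\mathsf{exc}(\pi)}=\sum_{i=0}^{\lfloor n/2\rfloor}b_{n,i}^{+}(q)\,t^i(1+t)^{n-2i}\quad\text{and}\quad \sum_{\pi\in\mathfrak{SD}_n^{-}}q^{\mathsf{stat}(\pi)}t^{\mathsf{exc}(\pi)}=\sum_{i=0}^{\lfloor n/2\rfloor}b_{n,i}^{-}(q)\,t^i(1+t)^{n-2i}.$$
   Context: Let $\mathfrak{S}_n$ be the symmetric group on $[n]$, $\mathcal{A}_n$ its even permutations, and $\mathfrak{SD}_n=\{\pi\in\mathfrak{S}_n:\pi_i\ne i\text{ for all } i\}$ the derangements; $\mathfrak{SD}_n^{+}=\mathfrak{SD}_n\cap\mathcal{A}_n$ and $\mathfrak{SD}_n^{-}=\mathfrak{SD}_n\setminus\mathcal{A}_n$. For $\pi\in\mathfrak{S}_n$: $\mathsf{exc}(\pi)=|\{i:\pi_i>i\}|$, $\mathsf{inv}(\pi)=|\{1\le i<j\le n:\pi_i>\pi_j\}|$, and $\mathsf{cyc}(\pi)$ is the number of cycles of $\pi$. *)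

theory Defs
  imports
    "HOL-Combinatorics.Permutations"
    "HOL-Combinatorics.Orbits"
    "HOL-Computational_Algebra.Polynomial"
begin

definition derangements :: "nat \<Rightarrow> (nat \<Rightarrow> nat) set" where
  "derangements n = {\<pi>. \<pi> permutes {1..n} \<and> (\<forall>i\<in>{1..n}. \<pi> i \<noteq> i)}"

definition even_derangements :: "nat \<Rightarrow> (nat \<Rightarrow> nat) set" where
  "even_derangements n = {\<pi> \<in> derangements n. evenperm \<pi>}"

definition odd_derangements :: "nat \<Rightarrow> (nat \<Rightarrow> nat) set" where
  "odd_derangements n = {\<pi> \<in> derangements n. \<not> evenperm \<pi>}"

definition exc_number :: "nat \<Rightarrow> (nat \<Rightarrow> nat) \<Rightarrow> nat" where
  "exc_number n \<pi> = card {i \<in> {1..n}. \<pi> i > i}"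

definition inv_number :: "nat \<Rightarrow> (nat \<Rightarrow> nat) \<Rightarrow> nat" where
  "inv_number n \<pi> = card {(i, j). 1 \<le> i \<and> i < j \<and> j \<le> n \<and> \<pi> i > \<pi> j}"

text \<open>The orbits of \<open>\<pi>\<close> on \<open>{1..n}\<close> are the supports of its cycles; fixed points count
  as cycles of length one.\<close>

definition cyc_number :: "nat \<Rightarrow> (nat \<Rightarrow> nat) \<Rightarrow> nat" where
  "cyc_number n \<pi> = card (orbit \<pi> ` {1..n})"

text \<open>\<open>\<int>[q][t]\<close> is represented as \<^typ>\<open>int poly poly\<close>: the outer indeterminate is \<open>t\<close>, the inner
  one is \<open>q\<close>.  So \<open>monom (monom 1 a) b\<close> is \<open>q\<^sup>a t\<^sup>b\<close>.\<close>

definition exc_gen_poly ::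
    "nat \<Rightarrow> ((nat \<Rightarrow> nat) \<Rightarrow> nat) \<Rightarrow> (nat \<Rightarrow> nat) set \<Rightarrow> int poly poly" where
  "exc_gen_poly n stat A = (\<Sum>\<pi>\<in>A. monom (monom 1 (stat \<pi>)) (exc_number n \<pi>))"

text \<open>\<open>\<Sum>\<^sub>i b\<^sub>i(q) t\<^sup>i (1 + t)\<^bsup>n - 2i\<^esup>\<close>; the subtraction in the exponent never truncates
  because \<open>i \<le> n div 2\<close>.\<close>

definition gamma_sum :: "nat \<Rightarrow> (nat \<Rightarrow> int poly) \<Rightarrow> int poly poly" where
  "gamma_sum n b = (\<Sum>i = 0..n div 2. smult (b i) (monom 1 i * [:1, 1:] ^ (n - 2 * i)))"

text \<open>``Positive coefficients'' means that every coefficient is non-negative: the zero polynomial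
  is admitted (the \<open>i = 0\<close> term always vanishes, since a derangement of a nonempty set has an
  excedance).\<close>

definition nonneg_coeffs :: "int poly \<Rightarrow> bool" where
  "nonneg_coeffs p \<longleftrightarrow> (\<forall>k. coeff p k \<ge> 0)"

end

theory Submission
  imports Defs
begin

text \<open>The polynomials of the required form with degree parameter \<open>m\<close> are generated from constants
  by sums, by multiplication with \<open>1 + t\<close> (\<open>m\<close> grows by one) and with \<open>t\<close> (\<open>m\<close> grows by two).
  The statistics enter only through an arbitrary weight function with non-negative values, so
  that restricting to even or odd permutations is a matter of choosing the weight.

  For \<open>cyc\<close>, removing the largest element \<open>a\<close> from a derangement of \<open>A\<close> leaves a derangement of
  \<open>A - {a}\<close>, or one of \<open>A - {a, b}\<close> if \<open>a\<close> and \<open>b\<close> form a 2-cycle. This gives the recurrence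
  \<open>f\<^sub>n\<^sub>+\<^sub>1 = n t f\<^sub>n + t (1 - t) f\<^sub>n' + n q t f\<^sub>n\<^sub>-\<^sub>1\<close>, whose terms all preserve the cone.

  For \<open>inv\<close>, a derangement is built up as a partial injection of \<open>{1..m}\<close>, in which \<open>k\<close> positions
  and \<open>k\<close> values are still unassigned. Position and value \<open>m + 1\<close> are either left unassigned or
  matched with an unassigned value or position, and the inversions gained depend only on \<open>k\<close>
  and the ranks of the chosen partners. Double ascents and double descents gain the
  same inversions, and together they contribute the factor \<open>1 + t\<close>.\<close>

subsection \<open>The cone of polynomials with non-negative gamma coefficients\<close>

lemma nonneg_coeffs_0 [simp]: "nonneg_coeffs 0"
  by (simp add: nonneg_coeffs_def)

lemma nonneg_coeffs_add: "nonneg_coeffs p \<Longrightarrow> nonneg_coeffs q \<Longrightarrow> nonneg_coeffs (p + q)"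
  by (simp add: nonneg_coeffs_def)

text \<open>The index \<open>m\<close> is twice the centre of symmetry of the polynomial in t, not
  its degree; hence multiplication by t raises it by two. As an inductive predicate, the cone yields
  closure properties by rule induction.\<close>

inductive gamma_cone :: "nat \<Rightarrow> int poly poly \<Rightarrow> bool" where
  zero: "gamma_cone m 0"
| const: "nonneg_coeffs c \<Longrightarrow> gamma_cone 0 [:c:]"
| add: "gamma_cone m P \<Longrightarrow> gamma_cone m Q \<Longrightarrow> gamma_cone m (P + Q)"
| linear: "gamma_cone m P \<Longrightarrow> gamma_cone (Suc m) ([:1, 1:] * P)"
| shift: "gamma_cone m P \<Longrightarrow> gamma_cone (Suc (Suc m)) ([:0, 1:] * P)"

lemma gamma_cone_sum: "(\<And>x. x \<in> A \<Longrightarrow> gamma_cone m (f x)) \<Longrightarrow> gamma_cone m (sum f A)"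
  by (induction A rule: infinite_finite_induct) (auto intro: gamma_cone.intros)

text \<open>When \<open>m\<close> is odd, the sum for \<open>Suc m\<close> has one more summand than
  the sum for \<open>m\<close>; the case distinction sets its coefficient to 0.\<close>

lemma gamma_sum_linear:
  "[:1, 1:] * gamma_sum m b = gamma_sum (Suc m) (\<lambda>i. if 2 * i \<le> m then b i else 0)"
proof -
  have "[:1, 1:] * gamma_sum m b =
      (\<Sum>i = 0..m div 2. smult (b i) (monom 1 i * [:1, 1:] ^ (Suc m - 2 * i)))"
    unfolding gamma_sum_def sum_distrib_left
    by (rule sum.cong) (simp_all add: Suc_diff_le algebra_simps del: mult_pCons_left mult_pCons_right)
  also have "\<dots> = gamma_sum (Suc m) (\<lambda>i. if 2 * i \<le> m then b i else 0)"
    unfolding gamma_sum_def by (rule sum.mono_neutral_cong_left) auto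
  finally show ?thesis .
qed

text \<open>The product of t with t^i (1 + t)^(m - 2i) is the basis element of index i + 1 for
  \<open>m + 2\<close>, so the coefficients move up one place behind a leading 0.\<close>

lemma gamma_sum_shift:
  "[:0, 1:] * gamma_sum m b = gamma_sum (Suc (Suc m)) (case_nat 0 b)"
proof -
  have eq: "[:0, 1:] * smult c (monom 1 i * Q) = smult c (monom 1 (Suc i) * Q)"
    for c :: "int poly" and i Q
    by (simp add: monom_Suc)
  have "gamma_sum (Suc (Suc m)) (case_nat 0 b) =
      (\<Sum>i = 0..m div 2. smult (b i) (monom 1 (Suc i) * [:1, 1:] ^ (m - 2 * i)))"
    unfolding gamma_sum_def by (simp add: sum.atLeast0_atMost_Suc_shift del: sum.cl_ivl_Suc)
  then show ?thesis
    unfolding gamma_sum_def sum_distrib_left eq by simp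
qed

lemma gamma_cone_imp_gamma_sum:
  assumes "gamma_cone m P"
  shows "\<exists>b. (\<forall>i. nonneg_coeffs (b i)) \<and> P = gamma_sum m b"
  using assms
proof induction
  case (zero m)
  show ?case by (intro exI[of _ "\<lambda>_. 0"]) (simp add: gamma_sum_def)
next
  case (const c)
  then show ?case by (intro exI[of _ "\<lambda>_. c"]) (simp add: gamma_sum_def)
next
  case (add m P Q)
  then obtain b b' where "\<forall>i. nonneg_coeffs (b i)" "P = gamma_sum m b"
      "\<forall>i. nonneg_coeffs (b' i)" "Q = gamma_sum m b'"
    by blast
  then show ?case
    by (intro exI[of _ "\<lambda>i. b i + b' i"])
       (simp add: nonneg_coeffs_add gamma_sum_def smult_add_left sum.distrib)
next
  case (linear m P)
  then obtain b where "\<forall>i. nonneg_coeffs (b i)" "P = gamma_sum m b"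
    by blast
  then show ?case
    by (intro exI[of _ "\<lambda>i. if 2 * i \<le> m then b i else 0"]) (simp only: gamma_sum_linear, simp)
next
  case (shift m P)
  then obtain b where "\<forall>i. nonneg_coeffs (b i)" "P = gamma_sum m b"
    by blast
  then show ?case
    by (intro exI[of _ "case_nat 0 b"]) (simp only: gamma_sum_shift, simp split: nat.split)
qed

section \<open>The operator of inserting a new maximum\<close>

definition insertion_op :: "nat \<Rightarrow> int poly poly \<Rightarrow> int poly poly" where
  "insertion_op n P = of_nat n * [:0, 1:] * P + ([:0, 1:] - [:0, 1:]\<^sup>2) * pderiv P"

lemma insertion_op_add: "insertion_op m (P + Q) = insertion_op m P + insertion_op m Q"
  by (simp add: insertion_op_def pderiv_add algebra_simps)

lemma insertion_op_sum: "insertion_op n (sum f A) = (\<Sum>x\<in>A. insertion_op n (f x))"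
  by (induction A rule: infinite_finite_induct)
     (simp_all add: insertion_op_add insertion_op_def[of _ 0])

text \<open>This is the Eulerian recurrence: of the \<open>n\<close> ways to insert a new maximum
  into a permutation with \<open>e\<close> excedances, \<open>e\<close> keep their number and
  \<open>n - e\<close> raise it by one.\<close>

lemma insertion_op_monom:
  assumes "e \<le> n"
  shows "insertion_op n (monom c e) = of_nat e * monom c e + of_nat (n - e) * monom c (Suc e)"
proof -
  have T: "[:0, 1:] * monom d k = monom d (Suc k)" for d :: "int poly" and k
    by (simp add: monom_Suc)
  have S: "of_nat k * monom d l = monom (of_nat k * d) l" for d :: "int poly" and k l
    by (simp add: of_nat_poly smult_monom)
  show ?thesis
  proof (cases e)
    case 0
    then show ?thesis
      by (simp add: insertion_op_def pderiv_monom T mult.assoc del: mult_pCons_left mult_pCons_right)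
  next
    case (Suc k)
    have "insertion_op n (monom c e) =
        monom (of_nat n * c) (Suc e) + monom (of_nat e * c) e - monom (of_nat e * c) (Suc e)"
      by (simp add: insertion_op_def pderiv_monom T S Suc mult.assoc left_diff_distrib power2_eq_square
          del: mult_pCons_left mult_pCons_right of_nat_Suc)
    also have "\<dots> = monom (of_nat e * c) e + monom (of_nat (n - e) * c) (Suc e)"
      using assms by (simp add: of_nat_diff left_diff_distrib diff_monom[symmetric])
    finally show ?thesis by (simp add: S)
  qed
qed

text \<open>\<open>insertion_op\<close> commutes with multiplication by \<open>1 + t\<close> and by \<open>t\<close> up to a term that lies
  in the cone again.\<close>

lemma gamma_cone_insertion_op:
  "gamma_cone m P \<Longrightarrow> gamma_cone (Suc m) (insertion_op m P)"
proof (induction rule: gamma_cone.induct)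
  case (zero m)
  show ?case by (simp add: insertion_op_def gamma_cone.zero)
next
  case (const c)
  show ?case by (simp add: insertion_op_def pderiv_pCons gamma_cone.zero)
next
  case (add m P Q)
  then show ?case by (simp add: insertion_op_add gamma_cone.add)
next
  case (linear m P)
  \<comment> \<open>Written as 1 + t, so that \<open>algebra\<close> can treat t as one
    atom.\<close>
  have T: "[:1, 1:] = 1 + ([:0, 1:] :: int poly poly)"
    by (simp add: one_pCons)
  have d: "pderiv [:0, 1 :: int poly:] = 1" "pderiv (1 :: int poly poly) = 0"
    by (simp_all add: pderiv_pCons one_pCons)
  \<comment> \<open>The defect is 2 t P, written as a sum of two elements provided by
    \<open>shift\<close>.\<close>
  have "insertion_op (Suc m) ([:1, 1:] * P) =
      [:1, 1:] * insertion_op m P + ([:0, 1:] * P + [:0, 1:] * P)"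
    unfolding insertion_op_def T pderiv_mult pderiv_add d by (simp only: of_nat_Suc) algebra
  with linear show ?case by (simp only: gamma_cone.intros)
next
  case (shift m P)
  have T: "[:1, 1:] = 1 + ([:0, 1:] :: int poly poly)"
    by (simp add: one_pCons)
  have d: "pderiv [:0, 1 :: int poly:] = 1"
    by (simp add: pderiv_pCons one_pCons)
  have "insertion_op (Suc (Suc m)) ([:0, 1:] * P) =
      [:0, 1:] * insertion_op m P + [:0, 1:] * ([:1, 1:] * P)"
    unfolding insertion_op_def T pderiv_mult d by (simp only: of_nat_Suc) algebra
  with shift show ?case by (simp only: gamma_cone.intros)
qed

subsection \<open>Cycles and excedances\<close>

text \<open>The product \<open>transpose a b \<circ> p\<close> inserts \<open>a\<close> into the
  cycle of \<open>b\<close>, immediately before \<open>b\<close>: the predecessor of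
  \<open>b\<close> goes to \<open>a\<close>, \<open>a\<close> goes to \<open>b\<close>, and all else
  in \<open>A\<close> is unchanged. Deleting \<open>a\<close> recovers the old cycle.\<close>

lemma orbit_transpose_comp:
  assumes p: "p permutes A" and a: "a \<notin> A" and b: "b \<in> A" and x: "x \<in> A"
  shows "orbit (transpose a b \<circ> p) x \<inter> A = orbit p x"
proof -
  define f where "f = transpose a b \<circ> p"
  have f1: "f z = p z" if "z \<in> A" "p z \<noteq> b" for z
  proof -
    have "p z \<noteq> a" using that(1) a permutes_in_image[OF p, of z] by auto
    then show ?thesis using that(2) by (simp add: f_def transpose_apply_other)
  qed
  have f2: "f z = a" if "p z = b" for z
    using that by (simp add: f_def)
  have f3: "f a = b"
    using permutes_not_in[OF p a] by (simp add: f_def)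
  have "orbit p x \<subseteq> orbit f x \<inter> A"
  proof
    fix y assume "y \<in> orbit p x"
    then show "y \<in> orbit f x \<inter> A"
    proof induction
      case base
      have "p x \<in> orbit f x"
      proof (cases "p x = b")
        case True
        then have "a \<in> orbit f x" using orbit.base[of f x] f2[of x] by simp
        then show ?thesis using orbit.step[of a f x] f3 True by simp
      qed (use orbit.base[of f x] f1[OF x] in simp)
      then show ?case using x permutes_in_image[OF p] by blast
    next
      case (step z)
      have "p z \<in> orbit f x"
      proof (cases "p z = b")
        case True
        then have "a \<in> orbit f x" using orbit.step[of z f x] f2[of z] step by simp
        then show ?thesis using orbit.step[of a f x] f3 True by simp
      qed (use orbit.step[of z f x] f1[of z] step in simp)
      then show ?case using step permutes_in_image[OF p] by blast
    qed
  qed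
  note lower = this
  have sub: "orbit p x \<subseteq> A" by (rule permutes_orbit_subset[OF p x])
  \<comment> \<open>The induction carries \<open>b \<in> orbit p x\<close> along with
    \<open>y = a\<close>, so that the step from \<open>a\<close> to \<open>b\<close> leads back into
    the old orbit.\<close>
  have "y \<in> orbit p x \<or> y = a \<and> b \<in> orbit p x" if "y \<in> orbit f x" for y
    using that
  proof induction
    case base
    show ?case
      using f1[OF x] f2[of x] orbit.base[of p x] by (cases "p x = b") simp_all
  next
    case (step z)
    then consider "z \<in> orbit p x" | "z = a" "b \<in> orbit p x" by blast
    then show ?case
    proof cases
      case 1
      then show ?thesis
        using f1[of z] f2[of z] orbit.step[OF 1] sub by (cases "p z = b") auto
    qed (use f3 in simp)
  qed
  with a have "orbit f x \<inter> A \<subseteq> orbit p x" by blast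
  with lower show ?thesis unfolding f_def by blast
qed

text \<open>Since \<open>a\<close> lies on the cycle of \<open>b\<close>, \<open>insert a A\<close>
  meets the same cycles as \<open>A\<close>. Intersecting with \<open>A\<close> maps these onto the
  old cycles, injectively because distinct cycles are disjoint.\<close>

lemma card_orbits_transpose_comp:
  assumes p: "p permutes A" and fin: "finite A" and a: "a \<notin> A" and b: "b \<in> A"
  shows "card (orbit (transpose a b \<circ> p) ` insert a A) = card (orbit p ` A)"
proof -
  let ?f = "transpose a b \<circ> p"
  have "?f permutes insert a A"
    using p b by (intro permutes_compose[OF permutes_subset[OF p]] permutes_swap_id) auto
  then have perm: "permutation ?f"
    using fin by (auto simp: permutation_permutes)
  have "?f a = b"
    using permutes_not_in[OF p a] by simp
  then have "orbit ?f a = orbit ?f b"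
    using permutation_orbit_step[OF perm, of a] by simp
  then have images: "orbit ?f ` insert a A = orbit ?f ` A"
    using b by auto
  have restrict: "orbit p ` A = (\<lambda>C. C \<inter> A) ` orbit ?f ` A"
    using orbit_transpose_comp[OF p a b] by (force simp: image_image)
  have "inj_on (\<lambda>C. C \<inter> A) (orbit ?f ` A)"
  proof (rule inj_onI, clarify)
    fix x y assume xy: "x \<in> A" "y \<in> A" and eq: "orbit ?f x \<inter> A = orbit ?f y \<inter> A"
    have "x \<in> orbit ?f y"
      using eq xy permutation_self_in_orbit[OF perm, of x] by blast
    then show "orbit ?f x = orbit ?f y"
      using orbit_cyclic_eq3[OF cyclic_on_orbit'[OF perm]] by simp
  qed
  from card_image[OF this] show ?thesis
    unfolding images restrict by (rule sym)
qed

section \<open>Removing the largest element of a derangement\<close>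

definition derangements_on :: "nat set \<Rightarrow> (nat \<Rightarrow> nat) set" where
  "derangements_on A = {\<pi>. \<pi> permutes A \<and> (\<forall>i\<in>A. \<pi> i \<noteq> i)}"

definition exc_on :: "nat set \<Rightarrow> (nat \<Rightarrow> nat) \<Rightarrow> nat" where
  "exc_on A \<pi> = card {i \<in> A. i < \<pi> i}"

definition cyc_on :: "nat set \<Rightarrow> (nat \<Rightarrow> nat) \<Rightarrow> nat" where
  "cyc_on A \<pi> = card (orbit \<pi> ` A)"

lemma finite_derangements_on: "finite A \<Longrightarrow> finite (derangements_on A)"
  unfolding derangements_on_def by (rule finite_subset[OF _ finite_permutations]) auto

text \<open>Composing with the transposition destroys the fixed point \<open>b\<close> and no other
  one in \<open>A\<close>. So \<open>p\<close> either has no fixed point or fixes just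
  \<open>b\<close>, and then \<open>a\<close> and \<open>b\<close> form a 2-cycle.\<close>

lemma transpose_comp_derangement_iff:
  assumes p: "p permutes A" and a: "a \<notin> A" and b: "b \<in> A"
  shows "transpose a b \<circ> p \<in> derangements_on (insert a A) \<longleftrightarrow>
    p \<in> derangements_on A \<or> p \<in> derangements_on (A - {b}) \<and> p b = b"
proof -
  have "transpose a b \<circ> p permutes insert a A"
    using p b by (intro permutes_compose[OF permutes_subset[OF p]] permutes_swap_id) auto
  moreover have "p permutes A - {b} \<longleftrightarrow> p b = b"
    using permutes_not_in[of p "A - {b}" b] permutes_superset[OF p, of "A - {b}"] by blast
  moreover have "(transpose a b \<circ> p) x = x \<longleftrightarrow> p x = x \<and> x \<noteq> b" if "x \<in> A" for x
  proof -
    have "p x \<noteq> a" "x \<noteq> a" using that a permutes_in_image[OF p, of x] by auto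
    then show ?thesis by (cases "p x = b") (auto simp: transpose_apply_other)
  qed
  moreover have "(transpose a b \<circ> p) a \<noteq> a"
    using permutes_not_in[OF p a] a b by auto
  ultimately show ?thesis
    using p b unfolding derangements_on_def by blast
qed

text \<open>The element \<open>c\<close> is now sent to \<open>a\<close> and becomes an excedance,
  while \<open>a\<close> is none. The count grows exactly if \<open>c\<close> was no excedance
  before; this includes \<open>p c = c\<close>, the case of a 2-cycle.\<close>

lemma exc_on_transpose_comp:
  assumes p: "p permutes A" and fin: "finite A" and a: "\<And>x. x \<in> A \<Longrightarrow> x < a" and c: "c \<in> A"
  shows "exc_on (insert a A) (transpose a (p c) \<circ> p) =
    (if c < p c then exc_on A p else Suc (exc_on A p))"
proof -
  define f where "f = transpose a (p c) \<circ> p"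
  have aA: "a \<notin> A" using a by blast
  have pc: "p c \<in> A" using permutes_in_image[OF p] c by simp
  have fa: "\<not> a < f a"
    using permutes_not_in[OF p aA] a[OF pc] by (simp add: f_def)
  have fc: "c < f c" using a[OF c] by (simp add: f_def)
  have fx: "f x = p x" if "x \<in> A" "x \<noteq> c" for x
  proof -
    have "p x \<noteq> p c" using that(2) permutes_inj[OF p] by (simp add: inj_eq)
    moreover have "p x \<noteq> a" using that(1) aA permutes_in_image[OF p, of x] by auto
    ultimately show ?thesis by (simp add: f_def transpose_apply_other)
  qed
  have "{i \<in> insert a A. i < f i} = insert c {i \<in> A. i < p i}" (is "?L = ?R")
  proof (rule set_eqI)
    fix x
    show "x \<in> ?L \<longleftrightarrow> x \<in> ?R"
      using fa fc c fx[of x] by (cases "x = a"; cases "x = c") auto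
  qed
  then have "exc_on (insert a A) f = card (insert c {i \<in> A. i < p i})"
    by (simp add: exc_on_def)
  also have "\<dots> = (if c < p c then exc_on A p else Suc (exc_on A p))"
    using c fin by (simp add: exc_on_def card_insert_if)
  finally show ?thesis unfolding f_def .
qed

text \<open>Recording \<open>b\<close> by its preimage \<open>c\<close> turns the sum into a count:
  excedances \<open>c\<close> keep the exponent, all other \<open>c\<close> raise it by one.\<close>

lemma sum_exc_on_transpose_comp:
  assumes p: "p permutes A" and fin: "finite A" and a: "\<And>x. x \<in> A \<Longrightarrow> x < a"
  shows "(\<Sum>b\<in>A. monom (d :: int poly) (exc_on (insert a A) (transpose a b \<circ> p))) =
    insertion_op (card A) (monom d (exc_on A p))"
proof -
  have "(\<Sum>b\<in>A. monom d (exc_on (insert a A) (transpose a b \<circ> p))) =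
      (\<Sum>c\<in>A. monom d (exc_on (insert a A) (transpose a (p c) \<circ> p)))"
    using sum.reindex_bij_betw[OF permutes_imp_bij[OF p]] by (rule sym)
  also have "\<dots> = (\<Sum>c\<in>A. if c < p c then monom d (exc_on A p) else monom d (Suc (exc_on A p)))"
    using exc_on_transpose_comp[OF p fin a] by (intro sum.cong) auto
  also have "\<dots> = of_nat (exc_on A p) * monom d (exc_on A p)
      + of_nat (card {c \<in> A. \<not> c < p c}) * monom d (Suc (exc_on A p))"
    using fin by (simp add: sum.If_cases exc_on_def Collect_conj_eq Compl_eq)
  also have "{c \<in> A. \<not> c < p c} = A - {c \<in> A. c < p c}"
    by blast
  also have "card \<dots> = card A - exc_on A p"
    unfolding exc_on_def using fin by (intro card_Diff_subset) auto
  finally show ?thesis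
    using fin by (subst insertion_op_monom) (auto simp: exc_on_def intro!: card_mono)
qed

text \<open>Arbitrary finite sets appear because \<open>A - {a, b}\<close> need not be an initial
  segment. The weight \<open>u\<close> is arbitrary because both reductions change it: inserting
  \<open>a\<close> flips the parity, and a 2-cycle moreover adds one to the number of
  cycles.\<close>

theorem gamma_cone_cyc:
  assumes "finite A" and "\<And>s k. nonneg_coeffs (u s k)"
  shows "gamma_cone (card A)
    (\<Sum>\<pi>\<in>derangements_on A. monom (u (evenperm \<pi>) (cyc_on A \<pi>)) (exc_on A \<pi>))"
  using assms
proof (induction "card A" arbitrary: A u rule: less_induct)
  case (less A)
  show ?case
  proof (cases "A = {}")
    case True
    have "monom (u True 0) 0 = [:u True 0:]" by (simp add: monom_0)
    with True less.prems show ?thesis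
      by (simp add: derangements_on_def cyc_on_def exc_on_def gamma_cone.const)
  next
    case False
    define a B where "a = Max A" and "B = A - {a}"
    have A: "A = insert a B" and finB: "finite B" and aB: "a \<notin> B"
      using Max_in[OF less.prems(1) False] less.prems(1) by (auto simp: a_def B_def)
    have lt: "x < a" if "x \<in> B" for x
      using that Max_ge[OF less.prems(1), of x] unfolding a_def B_def by simp
    have cardA: "card A = Suc (card B)"
      using card_insert_disjoint[OF finB aB] by (simp only: A)
    define F where "F \<pi> = monom (u (evenperm \<pi>) (cyc_on A \<pi>)) (exc_on A \<pi>)" for \<pi>
    have ev: "evenperm (transpose a b \<circ> p) = (\<not> evenperm p)" if "b \<in> B" "p permutes B" for b p
    proof -
      have "permutation p" using that(2) finB permutation_permutes by blast
      moreover have "a \<noteq> b" using that(1) aB by blast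
      ultimately show ?thesis
        by (simp add: evenperm_comp[OF permutation_swap_id] evenperm_swap)
    qed
    have cyc: "cyc_on A (transpose a b \<circ> p) = cyc_on B p" if "b \<in> B" "p permutes B" for b p
      using card_orbits_transpose_comp[OF that(2) finB aB that(1)] by (simp add: cyc_on_def A)
    \<comment> \<open>Extending the sum by zeros to all permutations allows each of them to be split
      as \<open>transpose a b \<circ> p\<close>.\<close>
    have "(\<Sum>\<pi>\<in>derangements_on A. F \<pi>) =
        (\<Sum>\<pi> | \<pi> permutes A. if \<pi> \<in> derangements_on A then F \<pi> else 0)"
      using less.prems by (intro sum.mono_neutral_cong_left)
        (auto simp: derangements_on_def finite_permutations)
    also have "\<dots> = (\<Sum>b\<in>A. \<Sum>p | p permutes B.
        if transpose a b \<circ> p \<in> derangements_on A then F (transpose a b \<circ> p) else 0)"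
      unfolding A by (rule sum_over_permutations_insert[OF finB aB])
    also have "\<dots> = (\<Sum>b\<in>B. \<Sum>p | p permutes B.
        if transpose a b \<circ> p \<in> derangements_on A then F (transpose a b \<circ> p) else 0)"
    proof -
      \<comment> \<open>The choice \<open>b = a\<close> would leave \<open>a\<close> fixed.\<close>
      have "transpose a a \<circ> p \<notin> derangements_on A" if "p permutes B" for p
        using permutes_not_in[OF that aB] A by (auto simp: derangements_on_def)
      then show ?thesis
        using A aB finB by simp
    qed
    also have "\<dots> = (\<Sum>b\<in>B. (\<Sum>p\<in>derangements_on B. F (transpose a b \<circ> p)) +
        (\<Sum>p\<in>derangements_on (B - {b}). F (transpose a b \<circ> p)))"
    proof (rule sum.cong[OF refl])
      fix b assume b: "b \<in> B"
      have derangements_permutes: "derangements_on C \<subseteq> {p. p permutes C}" for C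
        by (auto simp: derangements_on_def)
      have "p b = b" if "p \<in> derangements_on (B - {b})" for p
        using that permutes_not_in by (fastforce simp: derangements_on_def)
      moreover have "derangements_on (B - {b}) \<subseteq> {p. p permutes B}"
        unfolding derangements_on_def by (auto intro: permutes_subset)
      ultimately have "{p. p permutes B \<and> transpose a b \<circ> p \<in> derangements_on A} =
          derangements_on B \<union> derangements_on (B - {b})"
        using transpose_comp_derangement_iff[OF _ aB b, folded A] derangements_permutes[of B] by blast
      moreover have "derangements_on B \<inter> derangements_on (B - {b}) = {}"
        using b permutes_not_in by (fastforce simp: derangements_on_def)
      ultimately show "(\<Sum>p | p permutes B.
          if transpose a b \<circ> p \<in> derangements_on A then F (transpose a b \<circ> p) else 0) =
          (\<Sum>p\<in>derangements_on B. F (transpose a b \<circ> p)) +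
          (\<Sum>p\<in>derangements_on (B - {b}). F (transpose a b \<circ> p))"
        using finB finite_derangements_on
        by (simp add: sum.inter_filter[symmetric] finite_permutations sum.union_disjoint)
    qed
    also have "\<dots> = (\<Sum>p\<in>derangements_on B. \<Sum>b\<in>B. F (transpose a b \<circ> p)) +
        (\<Sum>b\<in>B. \<Sum>p\<in>derangements_on (B - {b}). F (transpose a b \<circ> p))"
      unfolding sum.distrib by (subst sum.swap) rule
    also have "gamma_cone (card A) \<dots>"
    proof (rule gamma_cone.add)
      have "(\<Sum>b\<in>B. F (transpose a b \<circ> p)) =
          insertion_op (card B) (monom (u (\<not> evenperm p) (cyc_on B p)) (exc_on B p))"
        if "p \<in> derangements_on B" for p
      proof -
        have p: "p permutes B" using that by (simp add: derangements_on_def)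
        then show ?thesis
          using sum_exc_on_transpose_comp[OF p finB lt, of "u (\<not> evenperm p) (cyc_on B p)"]
          by (simp add: F_def ev cyc A[symmetric])
      qed
      then have "(\<Sum>p\<in>derangements_on B. \<Sum>b\<in>B. F (transpose a b \<circ> p)) = insertion_op (card B)
          (\<Sum>p\<in>derangements_on B. monom (u (\<not> evenperm p) (cyc_on B p)) (exc_on B p))"
        by (simp add: insertion_op_sum)
      then show "gamma_cone (card A) (\<Sum>p\<in>derangements_on B. \<Sum>b\<in>B. F (transpose a b \<circ> p))"
        using less.hyps[of B "\<lambda>s. u (\<not> s)"] finB less.prems cardA
        by (simp add: gamma_cone_insertion_op)
    next
      have "gamma_cone (card A) (\<Sum>p\<in>derangements_on (B - {b}). F (transpose a b \<circ> p))"
        if b: "b \<in> B" for b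
      proof -
        have "F (transpose a b \<circ> p) =
            [:0, 1:] * monom (u (\<not> evenperm p) (Suc (cyc_on (B - {b}) p))) (exc_on (B - {b}) p)"
          if p: "p \<in> derangements_on (B - {b})" for p
        proof -
          have p': "p permutes B - {b}" "p permutes B"
            using p by (auto simp: derangements_on_def intro: permutes_subset)
          have pb: "p b = b" using permutes_not_in[OF p'(1)] by simp
          have "exc_on A (transpose a b \<circ> p) = Suc (exc_on B p)"
            using exc_on_transpose_comp[OF p'(2) finB lt b] pb A by simp
          also have "exc_on B p = exc_on (B - {b}) p"
            using pb unfolding exc_on_def by (intro arg_cong[of _ _ card]) auto
          finally have exc: "exc_on A (transpose a b \<circ> p) = Suc (exc_on (B - {b}) p)" .
          \<comment> \<open>As a permutation of \<open>B\<close>, \<open>p\<close> has the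
            additional cycle \<open>{b}\<close>; \<open>a\<close> joins it without changing the
            count.\<close>
          have "orbit p b = {b}" using pb by (simp add: orbit_eq_singleton_iff)
          moreover have "{b} \<notin> orbit p ` (B - {b})"
            using permutes_orbit_subset[OF p'(1)] by blast
          moreover have "orbit p ` B = insert (orbit p b) (orbit p ` (B - {b}))"
            using b by blast
          ultimately have "cyc_on B p = Suc (cyc_on (B - {b}) p)"
            using finB by (simp add: cyc_on_def)
          with exc show ?thesis
            using p' b by (simp add: F_def ev cyc monom_Suc)
        qed
        moreover have "gamma_cone (card (B - {b})) (\<Sum>p\<in>derangements_on (B - {b}).
            monom (u (\<not> evenperm p) (Suc (cyc_on (B - {b}) p))) (exc_on (B - {b}) p))"
          using finB b less.prems cardA
          by (intro less.hyps[of "B - {b}" "\<lambda>s k. u (\<not> s) (Suc k)"]) (auto simp: card_gt_0_iff less_Suc_eq_le)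
        moreover have "card A = Suc (Suc (card (B - {b})))"
          using cardA finB b by (metis card_Suc_Diff1)
        ultimately show ?thesis
          by (simp only: sum_distrib_left[symmetric] gamma_cone.shift cong: sum.cong)
      qed
      then show "gamma_cone (card A)
          (\<Sum>b\<in>B. \<Sum>p\<in>derangements_on (B - {b}). F (transpose a b \<circ> p))"
        by (rule gamma_cone_sum)
    qed
    finally show ?thesis unfolding F_def .
  qed
qed

subsection \<open>Inversions and parity\<close>

text \<open>Points are pairs of a position and a value. Inversions are counted in arbitrary sets of
  points, since the completions of partial injections used later need not be graphs of
  functions.\<close>

definition inverted :: "nat \<times> nat \<Rightarrow> nat \<times> nat \<Rightarrow> bool" where
  "inverted x y \<longleftrightarrow> fst x < fst y \<and> snd y < snd x"

definition inversions :: "(nat \<times> nat) set \<Rightarrow> nat" where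
  "inversions S = card {(x, y). x \<in> S \<and> y \<in> S \<and> inverted x y}"

definition inversions_with :: "nat \<times> nat \<Rightarrow> (nat \<times> nat) set \<Rightarrow> nat" where
  "inversions_with p S = card {x \<in> S. inverted x p \<or> inverted p x}"

lemma inversions_insert:
  assumes "finite S" and "p \<notin> S"
  shows "inversions (insert p S) = inversions S + inversions_with p S"
proof -
  let ?I = "{(x, y). x \<in> S \<and> y \<in> S \<and> inverted x y}"
  let ?P = "(\<lambda>x. (x, p)) ` {x \<in> S. inverted x p}" and ?Q = "(\<lambda>y. (p, y)) ` {y \<in> S. inverted p y}"
  have irr: "\<not> inverted p p" by (simp add: inverted_def)
  have "{(x, y). x \<in> insert p S \<and> y \<in> insert p S \<and> inverted x y} = ?I \<union> (?P \<union> ?Q)"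
    using irr by auto
  moreover have "finite ?I"
    using assms(1) by (intro finite_subset[of ?I "S \<times> S"]) auto
  moreover have "?I \<inter> (?P \<union> ?Q) = {}" "?P \<inter> ?Q = {}"
    using assms(2) by auto
  ultimately have "inversions (insert p S) = inversions S + (card ?P + card ?Q)"
    using assms(1) by (simp add: inversions_def card_Un_disjoint)
  also have "card ?P = card {x \<in> S. inverted x p}"
    by (rule card_image) (simp add: inj_on_def)
  also have "card ?Q = card {x \<in> S. inverted p x}"
    by (rule card_image) (simp add: inj_on_def)
  also have "card {x \<in> S. inverted x p} + card {x \<in> S. inverted p x} = inversions_with p S"
    unfolding inversions_with_def using assms(1)
    by (subst card_Un_disjoint[symmetric]) (auto simp: inverted_def intro: arg_cong[of _ _ card])
  finally show ?thesis .
qed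

lemma inversions_with_insert:
  assumes "finite S" and "p \<notin> S"
  shows "inversions_with q (insert p S) =
    (if inverted p q \<or> inverted q p then Suc (inversions_with q S) else inversions_with q S)"
proof -
  have "{x \<in> insert p S. inverted x q \<or> inverted q x} =
     (if inverted p q \<or> inverted q p then insert p {x \<in> S. inverted x q \<or> inverted q x}
      else {x \<in> S. inverted x q \<or> inverted q x})"
    by auto
  then show ?thesis
    using assms by (simp add: inversions_with_def)
qed

lemma inversions_converse: "inversions (S\<inverse>) = inversions S"
proof -
  have "bij_betw (\<lambda>(x, y). (prod.swap y, prod.swap x))
      {(x, y). x \<in> S\<inverse> \<and> y \<in> S\<inverse> \<and> inverted x y} {(x, y). x \<in> S \<and> y \<in> S \<and> inverted x y}"
    by (rule bij_betw_byWitness[where f' = "\<lambda>(x, y). (prod.swap y, prod.swap x)"])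
       (auto simp: inverted_def)
  then show ?thesis
    unfolding inversions_def by (rule bij_betw_same_card)
qed

definition graph_on :: "nat set \<Rightarrow> (nat \<Rightarrow> nat) \<Rightarrow> (nat \<times> nat) set" where
  "graph_on A f = (\<lambda>i. (i, f i)) ` A"

lemma inversions_graph_on:
  "inversions (graph_on {1..n} \<pi>) = inv_number n \<pi>"
proof -
  have "bij_betw (\<lambda>(i, j). ((i, \<pi> i), (j, \<pi> j))) {(i, j). 1 \<le> i \<and> i < j \<and> j \<le> n \<and> \<pi> i > \<pi> j}
     {(x, y). x \<in> graph_on {1..n} \<pi> \<and> y \<in> graph_on {1..n} \<pi> \<and> inverted x y}"
    by (rule bij_betw_byWitness[where f' = "\<lambda>(x, y). (fst x, fst y)"])
       (auto simp: inverted_def graph_on_def)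
  then show ?thesis
    unfolding inversions_def inv_number_def by (rule bij_betw_same_card[symmetric])
qed

text \<open>Replacing the point \<open>(c, p c)\<close> by \<open>(c, a)\<close> and \<open>(a, p c)\<close> with \<open>a\<close> maximal: a third point
  inverted with \<open>(c, p c)\<close> is inverted with exactly one of the two new points, and any other point
  with both or none.\<close>

lemma even_inversions_transpose_comp:
  assumes p: "p permutes A" and fin: "finite A" and a: "\<And>x. x \<in> A \<Longrightarrow> x < a" and b: "b \<in> A"
  shows "even (inversions (graph_on (insert a A) (transpose a b \<circ> p))) \<longleftrightarrow>
    odd (inversions (graph_on A p))"
proof -
  define f where "f = transpose a b \<circ> p"
  obtain c where c: "c \<in> A" "p c = b"
    using permutes_image[OF p] b by (metis imageE)
  define S where "S = graph_on (A - {c}) p"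
  have aA: "a \<notin> A" using a by blast
  have finS: "finite S" using fin by (simp add: S_def graph_on_def)
  have fx: "f x = p x" if "x \<in> A" "x \<noteq> c" for x
  proof -
    have "p x \<noteq> b" using that(2) c(2) permutes_inj[OF p] by (auto simp: inj_eq)
    moreover have "p x \<noteq> a" using that(1) aA permutes_in_image[OF p, of x] by auto
    ultimately show ?thesis by (simp add: f_def transpose_apply_other)
  qed
  have fa: "f a = b" and fc: "f c = a"
    using permutes_not_in[OF p aA] c by (simp_all add: f_def)
  have gp: "graph_on A p = insert (c, b) S"
    using c unfolding graph_on_def S_def by force
  have "graph_on (insert a A) f = insert (a, f a) (insert (c, f c) (graph_on (A - {c}) f))"
    using c(1) by (auto simp: graph_on_def)
  moreover have "graph_on (A - {c}) f = S"
    unfolding graph_on_def S_def using fx by (intro image_cong) auto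
  ultimately have gf: "graph_on (insert a A) f = insert (a, b) (insert (c, a) S)"
    by (simp only: fa fc)
  have bound: "fst x < a \<and> snd x < a \<and> fst x \<noteq> c \<and> snd x \<noteq> b" if x: "x \<in> S" for x
  proof -
    obtain i where i: "i \<in> A" "i \<noteq> c" "x = (i, p i)"
      using x by (auto simp: S_def graph_on_def)
    moreover have "p i \<noteq> b" using i(2) c(2) permutes_inj[OF p] by (auto simp: inj_eq)
    ultimately show ?thesis
      using a permutes_in_image[OF p, of i] by simp
  qed
  have notin: "(c, b) \<notin> S" "(c, a) \<notin> S" "(a, b) \<notin> insert (c, a) S"
    using bound[of "(c, b)"] bound[of "(c, a)"] bound[of "(a, b)"] c(1) aA by auto
  \<comment> \<open>These are three of the quadrants around \<open>(c, b)\<close>; points of the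
    fourth, to the lower left, are inverted with none of the three special points. \<open>V\<close>
    and \<open>W\<close> contribute once before and once after, \<open>U\<close> contributes twice
    after and not before. The two new points are inverted with each other, which makes the change
    odd.\<close>
  define U V W where "U = {x \<in> S. c < fst x \<and> b < snd x}"
    and "V = {x \<in> S. c < fst x \<and> snd x < b}" and "W = {x \<in> S. fst x < c \<and> b < snd x}"
  have fin3: "finite U" "finite V" "finite W"
    using finS by (simp_all add: U_def V_def W_def)
  have "x \<in> V \<union> W \<longleftrightarrow> x \<in> S \<and> (inverted x (c, b) \<or> inverted (c, b) x)"
      "x \<in> U \<union> V \<longleftrightarrow> x \<in> S \<and> (inverted x (c, a) \<or> inverted (c, a) x)"
      "x \<in> U \<union> W \<longleftrightarrow> x \<in> S \<and> (inverted x (a, b) \<or> inverted (a, b) x)" for x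
    using bound[of x] by (auto simp: U_def V_def W_def inverted_def neq_iff)
  then have "V \<union> W = {x \<in> S. inverted x (c, b) \<or> inverted (c, b) x}"
      "U \<union> V = {x \<in> S. inverted x (c, a) \<or> inverted (c, a) x}"
      "U \<union> W = {x \<in> S. inverted x (a, b) \<or> inverted (a, b) x}"
    by blast+
  then have "inversions_with (c, b) S = card (V \<union> W)" "inversions_with (c, a) S = card (U \<union> V)"
      "inversions_with (a, b) S = card (U \<union> W)"
    by (simp_all only: inversions_with_def)
  moreover have "card (V \<union> W) = card V + card W" "card (U \<union> V) = card U + card V"
      "card (U \<union> W) = card U + card W"
    using fin3 by (intro card_Un_disjoint; auto simp: U_def V_def W_def)+
  moreover have "inverted (c, a) (a, b)"
    using a b c by (simp add: inverted_def)
  ultimately have "inversions (graph_on (insert a A) f) + (card V + card W) =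
      inversions (graph_on A p) + Suc (2 * card U + card V + card W)"
    unfolding gp gf using finS notin
    by (simp add: inversions_insert inversions_with_insert)
  then have "inversions (graph_on (insert a A) f) = inversions (graph_on A p) + Suc (2 * card U)"
    by simp
  then show ?thesis unfolding f_def by simp
qed

text \<open>This makes the sign a function of the number of inversions, so that a weight depending
  on that number alone can select a parity. In \<open>transpose a b \<circ> p\<close> with
  \<open>a\<close> maximal, both parities flip if \<open>b\<close> differs from \<open>a\<close> and
  stay otherwise.\<close>

lemma evenperm_iff_even_inversions:
  assumes "finite A" and "\<pi> permutes A"
  shows "evenperm \<pi> \<longleftrightarrow> even (inversions (graph_on A \<pi>))"
  using assms
proof (induction A arbitrary: \<pi> rule: finite_linorder_max_induct)
  case empty
  then show ?case by (simp add: inversions_def graph_on_def)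
next
  case (insert a A)
  then have aA: "a \<notin> A" by blast
  from insert.prems have "\<pi> \<in> (\<lambda>(b, p). transpose a b \<circ> p) `
      {(b, p). b \<in> insert a A \<and> p \<in> {p. p permutes A}}"
    unfolding permutes_insert[symmetric] by simp
  then obtain b p where \<pi>: "\<pi> = transpose a b \<circ> p" and b: "b \<in> insert a A" and p: "p permutes A"
    by auto
  show ?case
  proof (cases "b = a")
    case True
    then have [simp]: "\<pi> = p" using \<pi> by simp
    have pa: "p a = a" by (rule permutes_not_in[OF p aA])
    have "\<not> inverted x (a, a)" "\<not> inverted (a, a) x" if "x \<in> graph_on A p" for x
      using that insert.hyps(2) permutes_in_image[OF p]
      by (auto simp: graph_on_def inverted_def not_less less_imp_le)
    then have "{x \<in> graph_on A p. inverted x (a, a) \<or> inverted (a, a) x} = {}"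
      by blast
    then have "inversions_with (a, a) (graph_on A p) = 0"
      by (simp only: inversions_with_def card.empty)
    moreover have "graph_on (insert a A) p = insert (a, a) (graph_on A p)"
      using pa by (simp add: graph_on_def)
    moreover have "(a, a) \<notin> graph_on A p"
      using aA by (auto simp: graph_on_def)
    moreover have "finite (graph_on A p)"
      using insert.hyps(1) by (simp add: graph_on_def)
    ultimately show ?thesis
      using insert.IH[OF p] by (simp add: inversions_insert)
  next
    case False
    have "permutation p" using p insert.hyps(1) permutation_permutes by blast
    with False have "evenperm \<pi> \<longleftrightarrow> \<not> evenperm p"
      by (simp add: \<pi> evenperm_comp[OF permutation_swap_id] evenperm_swap)
    moreover have "even (inversions (graph_on (insert a A) \<pi>)) \<longleftrightarrow> odd (inversions (graph_on A p))"
      unfolding \<pi> using insert.hyps(1,2) b False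
      by (intro even_inversions_transpose_comp[OF p]) auto
    ultimately show ?thesis
      using insert.IH[OF p] by simp
  qed
qed

subsection \<open>Partial derangements\<close>

text \<open>Relations are used so that the converse exchanges positions and values. There are two
  ground sets because a new value and a new position are added one after the other.\<close>

definition partial_derangements :: "nat set \<Rightarrow> nat set \<Rightarrow> (nat \<times> nat) set set" where
  "partial_derangements A B =
    {R. R \<subseteq> A \<times> B \<and> single_valued R \<and> single_valued (R\<inverse>) \<and> irrefl R}"

lemma finite_partial_derangements:
  "finite A \<Longrightarrow> finite B \<Longrightarrow> finite (partial_derangements A B)"
  by (rule finite_subset[of _ "Pow (A \<times> B)"]) (auto simp: partial_derangements_def)

lemma partial_derangements_converse:
  "R\<inverse> \<in> partial_derangements B A \<longleftrightarrow> R \<in> partial_derangements A B"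
  by (auto simp: partial_derangements_def irrefl_def)

text \<open>If \<open>b\<close> is taken as a value, its preimage is unique and differs from
  \<open>b\<close> by irreflexivity; removing this pair leaves a partial derangement without the
  value \<open>b\<close>.\<close>

lemma partial_derangements_insert:
  assumes b: "b \<notin> B"
  shows "partial_derangements A (insert b B) = partial_derangements A B \<union>
    (\<lambda>(R, i). insert (i, b) R) ` (SIGMA R:partial_derangements A B. A - Domain R - {b})"
    (is "?L = ?P \<union> ?Q")
proof
  show "?P \<union> ?Q \<subseteq> ?L"
  proof -
    have "insert (i, b) R \<in> ?L" if R: "R \<in> ?P" and i: "i \<in> A - Domain R - {b}" for R i
    proof -
      have "(i, y) \<notin> R" "(x, b) \<notin> R" for x y
        using R i b by (auto simp: partial_derangements_def)
      then show ?thesis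
        using R i by (auto simp: partial_derangements_def single_valued_def irrefl_def)
    qed
    moreover have "?P \<subseteq> ?L"
      by (auto simp: partial_derangements_def)
    ultimately show ?thesis by auto
  qed
  show "?L \<subseteq> ?P \<union> ?Q"
  proof
    fix R assume R: "R \<in> ?L"
    show "R \<in> ?P \<union> ?Q"
    proof (cases "b \<in> Range R")
      case False
      then have "R \<in> ?P" using R by (auto simp: partial_derangements_def)
      then show ?thesis ..
    next
      case True
      then obtain i where i: "(i, b) \<in> R" by auto
      have "R - {(i, b)} \<in> ?P"
        using R i by (auto simp: partial_derangements_def single_valued_def irrefl_def)
      moreover have "i \<in> A - Domain (R - {(i, b)}) - {b}"
        using R i by (auto simp: partial_derangements_def single_valued_def irrefl_def)
      moreover have "R = insert (i, b) (R - {(i, b)})"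
        using i by blast
      ultimately have "R \<in> ?Q" by blast
      then show ?thesis ..
    qed
  qed
qed

lemma sum_partial_derangements_insert:
  fixes F :: "(nat \<times> nat) set \<Rightarrow> 'b::comm_monoid_add"
  assumes b: "b \<notin> B" and fin: "finite A" "finite B"
  shows "(\<Sum>R\<in>partial_derangements A (insert b B). F R) =
    (\<Sum>R\<in>partial_derangements A B. F R + (\<Sum>i\<in>A - Domain R - {b}. F (insert (i, b) R)))"
proof -
  let ?S = "SIGMA R:partial_derangements A B. A - Domain R - {b}"
  have notin: "(j, b) \<notin> R" if "R \<in> partial_derangements A B" for R j
    using that b by (auto simp: partial_derangements_def)
  have inj: "inj_on (\<lambda>(R, i). insert (i, b) R) ?S"
  proof (rule inj_onI)
    fix x y assume xy: "x \<in> ?S" "y \<in> ?S"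
      and eq: "(\<lambda>(R, i). insert (i, b) R) x = (\<lambda>(R, i). insert (i, b) R) y"
    obtain R i R' i' where x: "x = (R, i)" and y: "y = (R', i')"
      by (cases x, cases y) blast
    have R: "R \<in> partial_derangements A B" "R' \<in> partial_derangements A B"
      using xy by (simp_all add: x y)
    have eq: "insert (i, b) R = insert (i', b) R'"
      using eq by (simp add: x y)
    have "i = i'" using eq notin[OF R(1)] notin[OF R(2)] by blast
    with eq show "x = y"
      using insert_ident[OF notin[OF R(1)] notin[OF R(2)]] by (simp add: x y)
  qed
  have "(\<Sum>R\<in>partial_derangements A (insert b B). F R) = sum F (partial_derangements A B)
      + sum F ((\<lambda>(R, i). insert (i, b) R) ` ?S)"
    unfolding partial_derangements_insert[OF b]
    using fin notin by (intro sum.union_disjoint) (auto intro: finite_partial_derangements)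
  also have "sum F ((\<lambda>(R, i). insert (i, b) R) ` ?S) =
      (\<Sum>R\<in>partial_derangements A B. \<Sum>i\<in>A - Domain R - {b}. F (insert (i, b) R))"
    using fin by (subst sum.reindex[OF inj], subst sum.Sigma)
      (auto simp: finite_partial_derangements comp_def case_prod_unfold)
  finally show ?thesis by (simp add: sum.distrib)
qed

text \<open>Summing over converses reduces the case of a new position to that of a new
  value.\<close>

lemma sum_partial_derangements_insert_converse:
  fixes F :: "(nat \<times> nat) set \<Rightarrow> 'b::comm_monoid_add"
  assumes a: "a \<notin> A" and fin: "finite A" "finite B"
  shows "(\<Sum>R\<in>partial_derangements (insert a A) B. F R) =
    (\<Sum>R\<in>partial_derangements A B. F R + (\<Sum>v\<in>B - Range R - {a}. F (insert (a, v) R)))"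
proof -
  have conv: "(\<Sum>R\<in>partial_derangements C D. G R) = (\<Sum>R\<in>partial_derangements D C. G (R\<inverse>))"
    for C D and G :: "(nat \<times> nat) set \<Rightarrow> 'b"
    by (rule sum.reindex_bij_witness[of _ converse converse])
       (auto simp: partial_derangements_converse)
  have conv_insert: "(insert (v, a) (R\<inverse>))\<inverse> = insert (a, v) R" for v and R :: "(nat \<times> nat) set"
    by auto
  have "(\<Sum>R\<in>partial_derangements (insert a A) B. F R) =
      (\<Sum>R\<in>partial_derangements B (insert a A). F (R\<inverse>))"
    by (rule conv)
  also have "\<dots> = (\<Sum>R\<in>partial_derangements B A. F (R\<inverse>) +
      (\<Sum>v\<in>B - Domain R - {a}. F ((insert (v, a) R)\<inverse>)))"
    by (rule sum_partial_derangements_insert[OF a fin(2,1)])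
  also have "\<dots> =
      (\<Sum>R\<in>partial_derangements A B. F R + (\<Sum>v\<in>B - Range R - {a}. F (insert (a, v) R)))"
    by (subst conv) (simp add: conv_insert)
  finally show ?thesis .
qed

text \<open>Unassigned positions and values are matched with a common point \<open>N\<close> that lies beyond
  all others, so that every unassigned position is inverted with every unassigned value.\<close>

definition completion :: "nat \<Rightarrow> nat set \<Rightarrow> nat set \<Rightarrow> (nat \<times> nat) set \<Rightarrow> (nat \<times> nat) set" where
  "completion N A B R = R \<union> (A - Domain R) \<times> {N} \<union> {N} \<times> (B - Range R)"

lemma completion_converse: "completion N B A (R\<inverse>) = (completion N A B R)\<inverse>"
  by (auto simp: completion_def)

lemma finite_completion:
  assumes "R \<in> partial_derangements A B" "finite A" "finite B"
  shows "finite (completion N A B R)"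
proof -
  have "finite R"
    using assms by (auto simp: partial_derangements_def intro: finite_subset[of R "A \<times> B"])
  with assms show ?thesis by (simp add: completion_def)
qed

text \<open>The only new point is \<open>(N, b)\<close>. Since \<open>b\<close> exceeds all values
  in \<open>B\<close>, it is inverted exactly with the points \<open>(i, N)\<close> of the
  unassigned positions \<open>i\<close>.\<close>

lemma inversions_completion_open:
  assumes R: "R \<in> partial_derangements A B" and fin: "finite A" "finite B"
    and A: "A \<subseteq> {..<N}" and B: "B \<subseteq> {..<b}" and b: "b < N"
  shows "inversions (completion N A (insert b B) R) =
    inversions (completion N A B R) + card (A - Domain R)"
proof -
  have RAB: "R \<subseteq> A \<times> B" using R by (simp add: partial_derangements_def)
  have "completion N A (insert b B) R = insert (N, b) (completion N A B R)"
    using RAB B by (auto simp: completion_def)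
  moreover have "(N, b) \<notin> completion N A B R"
    using RAB A B b by (auto simp: completion_def)
  moreover have "{x \<in> completion N A B R. inverted x (N, b) \<or> inverted (N, b) x} = (A - Domain R) \<times> {N}"
    using RAB A B b by (fastforce simp: completion_def inverted_def)
  ultimately show ?thesis
    using finite_completion[OF R fin] by (simp add: inversions_insert inversions_with_def card_cartesian_product)
qed

text \<open>The point \<open>(i, N)\<close> is lowered to \<open>(i, b)\<close>. As \<open>b\<close>
  is above all other values except \<open>N\<close>, old inversions of the point persist, and the
  new ones are with \<open>(j, N)\<close> for unassigned \<open>j < i\<close>. The gain is the rank
  of \<open>i\<close> among the unassigned positions.\<close>

lemma inversions_completion_insert:
  assumes R: "R \<in> partial_derangements A B" and fin: "finite A" "finite B"
    and A: "A \<subseteq> {..<N}" and B: "B \<subseteq> {..<b}" and b: "b < N" and i: "i \<in> A - Domain R"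
  shows "inversions (completion N A (insert b B) (insert (i, b) R)) =
    inversions (completion N A B R) + card {j \<in> A - Domain R. j < i}"
proof -
  have RAB: "R \<subseteq> A \<times> B" using R by (simp add: partial_derangements_def)
  define S where "S = completion N A B R - {(i, N)}"
  have finS: "finite S" using finite_completion[OF R fin] by (simp add: S_def)
  have old: "completion N A B R = insert (i, N) S"
    using i by (auto simp: S_def completion_def)
  have new: "completion N A (insert b B) (insert (i, b) R) = insert (i, b) S"
    using RAB A B b i by (auto simp: S_def completion_def)
  have notin: "(i, N) \<notin> S" "(i, b) \<notin> S"
    using RAB A B b i by (auto simp: S_def completion_def)
  let ?O = "{x \<in> S. inverted x (i, N) \<or> inverted (i, N) x}"
  have bound: "snd x \<noteq> b \<and> snd x \<le> N \<and> (snd x < b \<or> x \<in> (A - Domain R - {i}) \<times> {N})" if "x \<in> S" for x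
  proof (cases x)
    case (Pair j v)
    have "j \<in> A \<and> v \<in> B" if "(j, v) \<in> R" using that RAB by blast
    with \<open>x \<in> S\<close> show ?thesis
      using A B b Pair by (fastforce simp: S_def completion_def)
  qed
  have "x \<in> S \<and> (inverted x (i, b) \<or> inverted (i, b) x) \<longleftrightarrow>
      x \<in> ?O \<or> x \<in> {j \<in> A - Domain R. j < i} \<times> {N}" for x
  proof (cases "x \<in> S")
    case True
    then show ?thesis
      using bound[OF True] b by (auto simp: inverted_def)
  next
    case False
    then show ?thesis by (auto simp: S_def completion_def)
  qed
  then have "{x \<in> S. inverted x (i, b) \<or> inverted (i, b) x} =
      ?O \<union> {j \<in> A - Domain R. j < i} \<times> {N}"
    by blast
  then have "inversions_with (i, b) S = card (?O \<union> {j \<in> A - Domain R. j < i} \<times> {N})"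
    by (simp only: inversions_with_def)
  also have "\<dots> = inversions_with (i, N) S + card {j \<in> A - Domain R. j < i}"
    unfolding inversions_with_def using finS fin
    by (subst card_Un_disjoint) (auto simp: inverted_def card_cartesian_product)
  finally show ?thesis
    unfolding old new using finS notin by (simp add: inversions_insert)
qed

lemma inversions_completion_open_converse:
  assumes "R \<in> partial_derangements A B" and "finite A" "finite B"
    and "B \<subseteq> {..<N}" and "A \<subseteq> {..<a}" and "a < N"
  shows "inversions (completion N (insert a A) B R) =
    inversions (completion N A B R) + card (B - Range R)"
  using inversions_completion_open[of "R\<inverse>" B A N a] assms
  by (simp add: partial_derangements_converse completion_converse inversions_converse)

lemma inversions_completion_insert_converse:
  assumes "R \<in> partial_derangements A B" and "finite A" "finite B"
    and "B \<subseteq> {..<N}" and "A \<subseteq> {..<a}" and "a < N" and "v \<in> B - Range R"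
  shows "inversions (completion N (insert a A) B (insert (a, v) R)) =
    inversions (completion N A B R) + card {u \<in> B - Range R. u < v}"
proof -
  have "(insert (a, v) R)\<inverse> = insert (v, a) (R\<inverse>)" by auto
  then show ?thesis
    using inversions_completion_insert[of "R\<inverse>" B A N a v] assms
      completion_converse[of N B "insert a A" "insert (a, v) R"]
    by (simp add: partial_derangements_converse completion_converse inversions_converse)
qed

text \<open>The ranks of the elements of \<open>D\<close> run through 0, ...,
  \<open>card D - 1\<close>, each once.\<close>

lemma sum_rank:
  fixes g :: "nat \<Rightarrow> 'b::comm_monoid_add" and D :: "nat set"
  assumes "finite D"
  shows "(\<Sum>i\<in>D. g (card {j \<in> D. j < i})) = (\<Sum>a<card D. g a)"
  using assms
proof (induction D rule: finite_linorder_max_induct)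
  case empty
  show ?case by simp
next
  case (insert b D)
  then have "b \<notin> D" by blast
  have "{j \<in> insert b D. j < i} = {j \<in> D. j < i}" if "i \<in> D" for i
    using that insert.hyps(2) by auto
  moreover have "{j \<in> insert b D. j < b} = D"
    using insert.hyps(2) by auto
  ultimately show ?case
    using insert.hyps(1) insert.IH \<open>b \<notin> D\<close> by (simp add: add.commute)
qed

text \<open>Both projections are injective on \<open>R\<close>, so \<open>card R\<close> positions
  and equally many values are assigned.\<close>

lemma card_unassigned:
  assumes "R \<in> partial_derangements A A" and "finite A"
  shows "card (A - Range R) = card (A - Domain R)"
proof -
  have R: "R \<subseteq> A \<times> A" "single_valued R" "single_valued (R\<inverse>)"
    using assms(1) by (auto simp: partial_derangements_def)
  have "inj_on fst R" "inj_on snd R"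
    using R(2,3) by (auto simp: inj_on_def single_valued_def)
  then have "card (Domain R) = card R" "card (Range R) = card R"
    by (simp_all add: Domain_fst Range_snd card_image)
  moreover have "Domain R \<subseteq> A" "Range R \<subseteq> A"
    using R(1) by auto
  ultimately show ?thesis
    using assms(2) by (simp add: card_Diff_subset finite_subset)
qed

section \<open>The recurrence for sums over partial derangements\<close>

definition excedances :: "(nat \<times> nat) set \<Rightarrow> nat" where
  "excedances R = card {x \<in> R. fst x < snd x}"

lemma excedances_insert:
  assumes "finite R" and "p \<notin> R"
  shows "excedances (insert p R) = (if fst p < snd p then Suc (excedances R) else excedances R)"
proof -
  have "{x \<in> insert p R. fst x < snd x} =
      (if fst p < snd p then insert p {x \<in> R. fst x < snd x} else {x \<in> R. fst x < snd x})"
    by auto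
  with assms show ?thesis by (simp add: excedances_def)
qed

text \<open>Here \<open>k\<close> counts the unassigned positions, hence also the unassigned values.
  Keeping \<open>N\<close> as a parameter independent of \<open>m\<close> lets the same outer point
  serve at every stage of the induction.\<close>

definition open_sum :: "nat \<Rightarrow> nat \<Rightarrow> nat \<Rightarrow> (nat \<Rightarrow> int poly) \<Rightarrow> int poly poly" where
  "open_sum N m k w = (\<Sum>R\<in>partial_derangements {1..m} {1..m}.
     if card ({1..m} - Domain R) = k
     then monom (w (inversions (completion N {1..m} {1..m} R))) (excedances R) else 0)"

text \<open>The four summands correspond to \<open>Suc m\<close> being a cyclic valley, a double descent, a double
  ascent and a peak.\<close>

lemma extend_partial_derangement:
  fixes w :: "nat \<Rightarrow> int poly"
  defines "G \<equiv> \<lambda>m N k R. if card ({1..m} - Domain R) = k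
     then monom (w (inversions (completion N {1..m} {1..m} R))) (excedances R) else 0"
  assumes R: "R \<in> partial_derangements {1..m} {1..m}" and N: "Suc m < N"
  defines "c \<equiv> card ({1..m} - Domain R)"
    and "I \<equiv> inversions (completion N {1..m} {1..m} R)"
    and "M \<equiv> \<lambda>x. monom (w x) (excedances R)"
  shows "(G (Suc m) N k R + (\<Sum>v\<in>{1..Suc m} - Range R - {Suc m}. G (Suc m) N k (insert (Suc m, v) R))) +
     (\<Sum>i\<in>{1..m} - Domain R - {Suc m}. G (Suc m) N k (insert (i, Suc m) R) +
        (\<Sum>v\<in>{1..Suc m} - Range (insert (i, Suc m) R) - {Suc m}.
           G (Suc m) N k (insert (Suc m, v) (insert (i, Suc m) R)))) =
     (if Suc c = k then M (I + Suc (2 * c)) else 0) +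
     (if c = k then [:1, 1:] * (\<Sum>r<k. M (I + k + r)) else 0) +
     (if c = Suc k then [:0, 1:] * (\<Sum>r<Suc k. \<Sum>s<Suc k. M (I + r + s)) else 0)"
proof -
  define A a where "A = {1..m}" and "a = Suc m"
  have A': "{1..a} = insert a A" by (auto simp: A_def a_def)
  have fin: "finite A" "finite (insert a A)" and aA: "a \<notin> A"
    and bounds: "A \<subseteq> {..<N}" "A \<subseteq> {..<a}" "insert a A \<subseteq> {..<N}" "a < N"
    using N by (auto simp: A_def a_def)
  note R = R[folded A_def]
  have RA: "R \<subseteq> A \<times> A" using R by (simp add: partial_derangements_def)
  then have finR: "finite R" using fin(1) by (auto intro: finite_subset)
  have aR: "a \<notin> Domain R" "a \<notin> Range R" using RA aA by auto
  have R1: "R \<in> partial_derangements A (insert a A)"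
    using R by (auto simp: partial_derangements_def)
  define D V where "D = A - Domain R" and "V = A - Range R"
  have finDV: "finite D" "finite V" using fin by (simp_all add: D_def V_def)
  have cD: "card D = c" by (simp add: c_def D_def A_def)
  have cV: "card V = c" using card_unassigned[OF R fin(1)] cD by (simp add: D_def V_def)
  have aDV: "a \<notin> D" "a \<notin> V" using aA by (auto simp: D_def V_def)
  have I: "inversions (completion N A A R) = I" by (simp add: I_def A_def)
  have IA: "inversions (completion N A (insert a A) R) = I + c"
    using inversions_completion_open[OF R fin(1,1) bounds(1,2,4)] by (simp add: I cD D_def[symmetric])
  have V': "insert a A - Range R = insert a V"
    using aR by (auto simp: V_def)
  have G: "G a N k S = (if card (insert a A - Domain S) = k
      then monom (w (inversions (completion N (insert a A) (insert a A) S))) (excedances S) else 0)" for S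
    by (simp only: G_def A')
  \<comment> \<open>The new value \<open>a\<close> gains \<open>c\<close> inversions; the new
    position \<open>a\<close> then gains \<open>c + 1\<close>, as the value \<open>a\<close> is
    itself unassigned by that time.\<close>
  have valley: "G a N k R = (if Suc c = k then M (I + Suc (2 * c)) else 0)"
  proof -
    have "insert a A - Domain R = insert a D" using aR by (auto simp: D_def)
    then have "card (insert a A - Domain R) = Suc c"
      using finDV aDV cD by simp
    moreover have "inversions (completion N (insert a A) (insert a A) R) = I + Suc (2 * c)"
      using inversions_completion_open_converse[OF R1 fin(1,2) bounds(3,2,4)] V' finDV aDV cV IA
      by simp
    ultimately show ?thesis by (simp add: G M_def)
  qed
  \<comment> \<open>The unassigned value \<open>a\<close> gains \<open>c\<close> inversions, and
    matching position \<open>a\<close> with \<open>v\<close> gains the rank of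
    \<open>v\<close>.\<close>
  have descent: "G a N k (insert (a, v) R) =
      (if c = k then M (I + k + card {u \<in> V. u < v}) else 0)" if v: "v \<in> V" for v
  proof -
    have va: "v < a" "v \<in> A" using v bounds(2) by (auto simp: V_def)
    have "insert a A - Domain (insert (a, v) R) = D" using aA by (auto simp: D_def)
    moreover have "{u \<in> insert a A - Range R. u < v} = {u \<in> V. u < v}"
      using V' va by auto
    then have "inversions (completion N (insert a A) (insert a A) (insert (a, v) R)) =
        I + c + card {u \<in> V. u < v}"
      using inversions_completion_insert_converse[OF R1 fin(1,2) bounds(3,2,4), of v] V' v IA
      by simp
    moreover have "excedances (insert (a, v) R) = excedances R"
      using excedances_insert[OF finR, of "(a, v)"] aR va by auto
    ultimately show ?thesis by (simp add: G M_def cD)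
  qed
  \<comment> \<open>Matching \<open>i\<close> with the value \<open>a\<close> gains the rank of
    \<open>i\<close> and one excedance. Position \<open>a\<close> gains \<open>c\<close> if left
    unassigned, and the rank of \<open>v\<close> if matched with \<open>v\<close>.\<close>
  have ascent: "G a N k (insert (i, a) R) =
      (if c = k then [:0, 1:] * M (I + k + card {j \<in> D. j < i}) else 0)"
    and peak: "v \<in> V \<Longrightarrow> G a N k (insert (a, v) (insert (i, a) R)) =
      (if c = Suc k then [:0, 1:] * M (I + card {j \<in> D. j < i} + card {u \<in> V. u < v}) else 0)"
    and range: "insert a A - Range (insert (i, a) R) - {a} = V"
    if i: "i \<in> D" for i v
  proof -
    have ia: "i < a" "i \<in> A" "i \<notin> Domain R" using i bounds(2) by (auto simp: D_def)
    define S where "S = insert (i, a) R"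
    have "S \<in> partial_derangements A (insert a A)"
      using partial_derangements_insert[OF aA, of A] R i aDV unfolding S_def D_def by force
    note S = this
    have finS: "finite S" using finR by (simp add: S_def)
    have VS: "insert a A - Range S = V" using aA by (auto simp: S_def V_def)
    then show "insert a A - Range (insert (i, a) R) - {a} = V"
      using aDV by (simp add: S_def)
    have IS: "inversions (completion N A (insert a A) S) = I + card {j \<in> D. j < i}"
      using inversions_completion_insert[OF R fin(1,1) bounds(1,2,4), of i] i
      by (simp add: I D_def S_def)
    have exS: "excedances S = Suc (excedances R)"
      using excedances_insert[OF finR, of "(i, a)"] aR ia by (auto simp: S_def)
    have aS: "a \<notin> Domain S" using aR ia by (auto simp: S_def)
    have c: "c = Suc (card (D - {i}))"
      using cD card_Suc_Diff1[OF finDV(1) i] by simp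
    show "G a N k (insert (i, a) R) =
        (if c = k then [:0, 1:] * M (I + k + card {j \<in> D. j < i}) else 0)"
    proof -
      have "insert a A - Domain S = insert a (D - {i})"
        using aS aA by (auto simp: D_def S_def)
      then have "card (insert a A - Domain S) = c"
        using finDV aDV c by simp
      moreover have "inversions (completion N (insert a A) (insert a A) S) = I + c + card {j \<in> D. j < i}"
        using inversions_completion_open_converse[OF S fin(1,2) bounds(3,2,4)] VS cV IS by simp
      ultimately show ?thesis
        unfolding S_def[symmetric] G by (simp add: M_def exS monom_Suc)
    qed
    show "G a N k (insert (a, v) (insert (i, a) R)) =
      (if c = Suc k then [:0, 1:] * M (I + card {j \<in> D. j < i} + card {u \<in> V. u < v}) else 0)"
      if v: "v \<in> V"
    proof -
      have va: "v < a" using v bounds(2) by (auto simp: V_def)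
      have "insert a A - Domain (insert (a, v) S) = D - {i}"
        using aA by (auto simp: D_def S_def)
      then have "card (insert a A - Domain (insert (a, v) S)) = k \<longleftrightarrow> c = Suc k"
        using c by simp
      moreover have "inversions (completion N (insert a A) (insert a A) (insert (a, v) S)) =
          I + card {j \<in> D. j < i} + card {u \<in> V. u < v}"
        using inversions_completion_insert_converse[OF S fin(1,2) bounds(3,2,4), of v] VS v IS by simp
      moreover have "excedances (insert (a, v) S) = Suc (excedances R)"
        using excedances_insert[OF finS, of "(a, v)"] aS va exS by auto
      ultimately show ?thesis
        unfolding S_def[symmetric] G by (simp add: M_def monom_Suc)
    qed
  qed
  have sets: "insert a A - Range R - {a} = V" "A - Domain R - {a} = D"
    using aR aA by (auto simp: V_def D_def)
  \<comment> \<open>Partners matter only through their ranks, and \<open>D\<close> and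
    \<open>V\<close> have the same ranks; hence ascents give t times the sum for descents.\<close>
  have rankV: "(\<Sum>v\<in>V. g (card {u \<in> V. u < v})) = (\<Sum>r<c. g r)" for g :: "nat \<Rightarrow> int poly poly"
    using sum_rank[OF finDV(2)] cV by simp
  have rankD: "(\<Sum>i\<in>D. g (card {j \<in> D. j < i})) = (\<Sum>r<c. g r)" for g :: "nat \<Rightarrow> int poly poly"
    using sum_rank[OF finDV(1)] cD by simp
  have descents: "(\<Sum>v\<in>V. G a N k (insert (a, v) R)) = (if c = k then \<Sum>r<k. M (I + k + r) else 0)"
  proof -
    have "(\<Sum>v\<in>V. G a N k (insert (a, v) R)) =
        (\<Sum>v\<in>V. if c = k then M (I + k + card {u \<in> V. u < v}) else 0)"
      using descent by (rule sum.cong[OF refl])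
    then show ?thesis
      using rankV[of "\<lambda>r. M (I + k + r)"] by auto
  qed
  have ascents: "(\<Sum>i\<in>D. G a N k (insert (i, a) R)) =
      (if c = k then [:0, 1:] * (\<Sum>r<k. M (I + k + r)) else 0)"
  proof -
    have "(\<Sum>i\<in>D. G a N k (insert (i, a) R)) =
        (\<Sum>i\<in>D. if c = k then [:0, 1:] * M (I + k + card {j \<in> D. j < i}) else 0)"
      using ascent by (rule sum.cong[OF refl])
    then show ?thesis
      using rankD[of "\<lambda>r. [:0, 1:] * M (I + k + r)"] unfolding sum_distrib_left by auto
  qed
  have peaks: "(\<Sum>i\<in>D. \<Sum>v\<in>insert a A - Range (insert (i, a) R) - {a}.
      G a N k (insert (a, v) (insert (i, a) R))) =
      (if c = Suc k then [:0, 1:] * (\<Sum>r<Suc k. \<Sum>s<Suc k. M (I + r + s)) else 0)"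
  proof -
    have "(\<Sum>i\<in>D. \<Sum>v\<in>insert a A - Range (insert (i, a) R) - {a}.
        G a N k (insert (a, v) (insert (i, a) R))) =
        (\<Sum>i\<in>D. \<Sum>v\<in>V. if c = Suc k
          then [:0, 1:] * M (I + card {j \<in> D. j < i} + card {u \<in> V. u < v}) else 0)"
      using range peak by (intro sum.cong) auto
    also have "\<dots> = (\<Sum>i\<in>D. \<Sum>s<c. if c = Suc k then [:0, 1:] * M (I + card {j \<in> D. j < i} + s) else 0)"
      by (rule sum.cong[OF refl],
          rule rankV[of "\<lambda>s. if c = Suc k then [:0, 1:] * M (I + card {j \<in> D. j < i} + s) else 0" for i])
    also have "\<dots> = (\<Sum>r<c. \<Sum>s<c. if c = Suc k then [:0, 1:] * M (I + r + s) else 0)"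
      using rankD[of "\<lambda>r. \<Sum>s<c. if c = Suc k then [:0, 1:] * M (I + r + s) else 0"] .
    finally show ?thesis
      unfolding sum_distrib_left by auto
  qed
  have "v + (if b then X else 0) + ((if b then [:0, 1:] * X else 0) + Z) =
      v + (if b then [:1, 1:] * X else 0) + Z" for v X Z :: "int poly poly" and b
    by simp
  then show ?thesis
    unfolding a_def[symmetric] A_def[symmetric] A' sets sum.distrib valley descents ascents peaks .
qed

text \<open>The inversions gained are absorbed into the weight, so that only open sums for
  \<open>m\<close> occur. The first summand vanishes for \<open>k = 0\<close> because a valley
  leaves a position unassigned.\<close>

lemma open_sum_Suc:
  assumes N: "Suc m < N"
  shows "open_sum N (Suc m) k w =
    (case k of 0 \<Rightarrow> 0 | Suc l \<Rightarrow> open_sum N m l (\<lambda>x. w (x + Suc (2 * l)))) +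
    [:1, 1:] * (\<Sum>r<k. open_sum N m k (\<lambda>x. w (x + k + r))) +
    [:0, 1:] * (\<Sum>r<Suc k. \<Sum>s<Suc k. open_sum N m (Suc k) (\<lambda>x. w (x + r + s)))"
proof -
  define P where "P = partial_derangements {1..m} {1..m}"
  have insert_eq: "{1..Suc m} = insert (Suc m) {1..m}" by auto
  have decompose: "(\<Sum>R\<in>partial_derangements {1..Suc m} {1..Suc m}. F R) =
      (\<Sum>R\<in>P. (F R + (\<Sum>v\<in>{1..Suc m} - Range R - {Suc m}. F (insert (Suc m, v) R))) +
        (\<Sum>i\<in>{1..m} - Domain R - {Suc m}. F (insert (i, Suc m) R) +
          (\<Sum>v\<in>{1..Suc m} - Range (insert (i, Suc m) R) - {Suc m}.
            F (insert (Suc m, v) (insert (i, Suc m) R)))))" for F :: "_ \<Rightarrow> int poly poly"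
    unfolding insert_eq P_def
    by (subst sum_partial_derangements_insert_converse, simp, simp, simp,
        subst sum_partial_derangements_insert, simp, simp, simp)
  define c where "c R = card ({1..m} - Domain R)" for R :: "(nat \<times> nat) set"
  define I where "I R = inversions (completion N {1..m} {1..m} R)" for R
  define M where "M x R = monom (w x) (excedances R)" for x R
  have "open_sum N (Suc m) k w = (\<Sum>R\<in>P.
     (if Suc (c R) = k then M (I R + Suc (2 * c R)) R else 0) +
     (if c R = k then [:1, 1:] * (\<Sum>r<k. M (I R + k + r) R) else 0) +
     (if c R = Suc k then [:0, 1:] * (\<Sum>r<Suc k. \<Sum>s<Suc k. M (I R + r + s) R) else 0))"
    unfolding open_sum_def decompose c_def I_def M_def P_def
    by (intro sum.cong refl extend_partial_derangement N)
  moreover have "(\<Sum>R\<in>P. if Suc (c R) = k then M (I R + Suc (2 * c R)) R else 0) =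
      (case k of 0 \<Rightarrow> 0 | Suc l \<Rightarrow> open_sum N m l (\<lambda>x. w (x + Suc (2 * l))))"
    unfolding open_sum_def P_def c_def I_def M_def by (auto split: nat.split intro!: sum.cong)
  moreover have "(\<Sum>R\<in>P. if c R = k then [:1, 1:] * (\<Sum>r<k. M (I R + k + r) R) else 0) =
      [:1, 1:] * (\<Sum>r<k. open_sum N m k (\<lambda>x. w (x + k + r)))"
  proof -
    have *: "(\<Sum>r<k. open_sum N m k (\<lambda>x. w (x + k + r))) =
        (\<Sum>R\<in>P. \<Sum>r<k. if c R = k then M (I R + k + r) R else 0)"
      unfolding open_sum_def P_def c_def I_def M_def by (rule sum.swap)
    show ?thesis
      unfolding * sum_distrib_left by (intro sum.cong) auto
  qed
  moreover have "(\<Sum>R\<in>P. if c R = Suc k then [:0, 1:] * (\<Sum>r<Suc k. \<Sum>s<Suc k. M (I R + r + s) R) else 0) =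
      [:0, 1:] * (\<Sum>r<Suc k. \<Sum>s<Suc k. open_sum N m (Suc k) (\<lambda>x. w (x + r + s)))"
  proof -
    have "(\<Sum>r<Suc k. \<Sum>s<Suc k. open_sum N m (Suc k) (\<lambda>x. w (x + r + s))) =
        (\<Sum>r<Suc k. \<Sum>R\<in>P. \<Sum>s<Suc k. if c R = Suc k then M (I R + r + s) R else 0)"
      unfolding open_sum_def P_def c_def I_def M_def by (intro sum.cong refl, rule sum.swap)
    also have "\<dots> = (\<Sum>R\<in>P. \<Sum>r<Suc k. \<Sum>s<Suc k. if c R = Suc k then M (I R + r + s) R else 0)"
      by (rule sum.swap)
    finally have *: "(\<Sum>r<Suc k. \<Sum>s<Suc k. open_sum N m (Suc k) (\<lambda>x. w (x + r + s))) = \<dots>" .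
    show ?thesis
      unfolding * sum_distrib_left by (rule sum.cong) (simp_all del: sum.lessThan_Suc mult_pCons_left)
  qed
  ultimately show ?thesis
    by (simp only: sum.distrib)
qed

lemma open_sum_eq_0:
  assumes "m < k"
  shows "open_sum N m k w = 0"
proof -
  have "card ({1..m} - Domain R) \<noteq> k" for R :: "(nat \<times> nat) set"
    using card_mono[of "{1..m}" "{1..m} - Domain R"] assms by auto
  then show ?thesis by (simp add: open_sum_def)
qed

text \<open>The index \<open>m - k\<close> fits the recurrence: a valley keeps it, the factor 1 + t
  goes with a rise by one, and a peak, with factor t, raises it from \<open>m - Suc k\<close> to
  \<open>Suc m - k\<close>, that is by two. Where the subtraction would truncate, the sum is
  0.\<close>

lemma gamma_cone_open_sum:
  assumes "m < N" and "\<And>x. nonneg_coeffs (w x)"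
  shows "gamma_cone (m - k) (open_sum N m k w)"
  using assms
proof (induction m arbitrary: k w)
  case 0
  have "partial_derangements {1..0} {1..0} = {{}}"
    by (auto simp: partial_derangements_def irrefl_def)
  moreover have "inversions (completion N {1..0} {1..0} {}) = 0" "excedances {} = 0"
    by (simp_all add: completion_def inversions_def excedances_def)
  ultimately have "open_sum N 0 k w = (if k = 0 then [:w 0:] else 0)"
    unfolding open_sum_def by (simp add: monom_0)
  then show ?case
    using 0 by (simp add: gamma_cone.zero gamma_cone.const)
next
  case (Suc m)
  note IH = Suc.IH[OF Suc_lessD[OF Suc.prems(1)]]
  show ?case
  proof (cases "Suc m < k")
    case True
    then show ?thesis by (simp add: open_sum_eq_0 gamma_cone.zero)
  next
    case False
    have "gamma_cone (Suc m - k) (case k of 0 \<Rightarrow> 0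
        | Suc l \<Rightarrow> open_sum N m l (\<lambda>x. w (x + Suc (2 * l))))"
      using IH Suc.prems(2) by (auto split: nat.split intro: gamma_cone.zero)
    moreover have "gamma_cone (Suc m - k) ([:1, 1:] * (\<Sum>r<k. open_sum N m k (\<lambda>x. w (x + k + r))))"
    proof (cases "k \<le> m")
      case True
      have "gamma_cone (m - k) (\<Sum>r<k. open_sum N m k (\<lambda>x. w (x + k + r)))"
        by (intro gamma_cone_sum IH Suc.prems(2))
      from gamma_cone.linear[OF this] show ?thesis
        using True by (simp only: Suc_diff_le)
    next
      case False
      then show ?thesis by (simp add: open_sum_eq_0 gamma_cone.zero)
    qed
    moreover have "gamma_cone (Suc m - k)
        ([:0, 1:] * (\<Sum>r<Suc k. \<Sum>s<Suc k. open_sum N m (Suc k) (\<lambda>x. w (x + r + s))))"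
    proof (cases "Suc k \<le> m")
      case True
      then have "Suc m - k = Suc (Suc (m - Suc k))" by simp
      moreover have "gamma_cone (m - Suc k)
          (\<Sum>r<Suc k. \<Sum>s<Suc k. open_sum N m (Suc k) (\<lambda>x. w (x + r + s)))"
        by (intro gamma_cone_sum IH Suc.prems(2))
      ultimately show ?thesis
        by (simp only: gamma_cone.shift)
    next
      case False
      then show ?thesis by (simp add: open_sum_eq_0 gamma_cone.zero del: sum.lessThan_Suc)
    qed
    ultimately show ?thesis
      unfolding open_sum_Suc[OF Suc.prems(1)] by (intro gamma_cone.add)
  qed
qed

section \<open>Derangements as partial derangements with nothing unassigned\<close>

lemma bij_betw_graph_on_derangements:
  assumes fin: "finite A"
  shows "bij_betw (graph_on A) (derangements_on A) {R \<in> partial_derangements A A. A \<subseteq> Domain R}"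
  unfolding bij_betw_def
proof
  show "inj_on (graph_on A) (derangements_on A)"
  proof (rule inj_onI, rule ext)
    fix \<pi> \<sigma> x
    assume \<pi>: "\<pi> \<in> derangements_on A" and \<sigma>: "\<sigma> \<in> derangements_on A"
      and eq: "graph_on A \<pi> = graph_on A \<sigma>"
    show "\<pi> x = \<sigma> x"
    proof (cases "x \<in> A")
      case True
      then have "(x, \<pi> x) \<in> graph_on A \<sigma>"
        unfolding eq[symmetric] by (simp add: graph_on_def)
      then show ?thesis by (auto simp: graph_on_def)
    next
      case False
      then show ?thesis
        using \<pi> \<sigma> permutes_not_in[of \<pi> A x] permutes_not_in[of \<sigma> A x]
        by (simp add: derangements_on_def)
    qed
  qed
  show "graph_on A ` derangements_on A = {R \<in> partial_derangements A A. A \<subseteq> Domain R}" (is "?L = ?R")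
  proof
    show "?L \<subseteq> ?R"
    proof (rule image_subsetI)
      fix \<pi> assume \<pi>: "\<pi> \<in> derangements_on A"
      then have p: "\<pi> permutes A" by (simp add: derangements_on_def)
      show "graph_on A \<pi> \<in> ?R"
        using \<pi> permutes_in_image[OF p] permutes_inj[OF p]
        by (auto simp: partial_derangements_def derangements_on_def graph_on_def single_valued_def
            irrefl_def inj_eq)
    qed
    show "?R \<subseteq> ?L"
    proof
      fix R assume R: "R \<in> ?R"
      then have sub: "R \<subseteq> A \<times> A" and sv: "single_valued R" "single_valued (R\<inverse>)" and irr: "irrefl R"
        and dom: "\<forall>i\<in>A. \<exists>j. (i, j) \<in> R"
        by (auto simp: partial_derangements_def)
      from dom obtain g where g: "\<And>i. i \<in> A \<Longrightarrow> (i, g i) \<in> R" by metis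
      define \<pi> where "\<pi> i = (if i \<in> A then g i else i)" for i
      have \<pi>: "(i, \<pi> i) \<in> R" if "i \<in> A" for i
        using g that by (simp add: \<pi>_def)
      have "inj_on \<pi> A"
        using \<pi> sv(2) by (intro inj_onI) (metis converseI single_valuedD)
      moreover have "\<pi> ` A \<subseteq> A" using \<pi> sub by blast
      ultimately have "bij_betw \<pi> A A"
        using fin by (simp add: bij_betw_def endo_inj_surj)
      then have "\<pi> permutes A"
        by (rule bij_imp_permutes) (simp add: \<pi>_def)
      moreover have "\<pi> i \<noteq> i" if "i \<in> A" for i
        using \<pi>[OF that] irr by (auto simp: irrefl_def)
      ultimately have "\<pi> \<in> derangements_on A"
        by (simp add: derangements_on_def)
      moreover have "R = graph_on A \<pi>"
      proof
        show "graph_on A \<pi> \<subseteq> R" using \<pi> by (auto simp: graph_on_def)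
        show "R \<subseteq> graph_on A \<pi>"
        proof
          fix x assume x: "x \<in> R"
          obtain i j where [simp]: "x = (i, j)" by (cases x)
          have "i \<in> A" using x sub by auto
          moreover have "j = \<pi> i"
            using single_valuedD[OF sv(1), of i j "\<pi> i"] x \<pi>[OF \<open>i \<in> A\<close>] by simp
          ultimately show "x \<in> graph_on A \<pi>" by (simp add: graph_on_def)
        qed
      qed
      ultimately show "R \<in> ?L" by blast
    qed
  qed
qed

theorem gamma_cone_inv:
  assumes "\<And>k. nonneg_coeffs (w k)"
  shows "gamma_cone n (\<Sum>\<pi>\<in>derangements n. monom (w (inv_number n \<pi>)) (exc_number n \<pi>))"
proof -
  define A where "A = {1..n}"
  have fin: "finite A" by (simp add: A_def)
  have der: "derangements n = derangements_on A"
    by (simp add: derangements_def derangements_on_def A_def)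
  have "open_sum (Suc n) n 0 w = (\<Sum>R | R \<in> partial_derangements A A \<and> A \<subseteq> Domain R.
      monom (w (inversions R)) (excedances R))"
  proof -
    have "(if card (A - Domain R) = 0
        then monom (w (inversions (completion (Suc n) A A R))) (excedances R) else 0) =
        (if A \<subseteq> Domain R then monom (w (inversions R)) (excedances R) else 0)"
      if R: "R \<in> partial_derangements A A" for R
    proof -
      \<comment> \<open>If all positions are assigned, then by counting so are all values, and the
        completion adds no points.\<close>
      have "completion (Suc n) A A R = R" if "A \<subseteq> Domain R"
      proof -
        have D: "A - Domain R = {}" using that by blast
        have "card (A - Range R) = 0" by (simp only: card_unassigned[OF R fin] D card.empty)
        then have "A - Range R = {}" using fin by (simp only: card_0_eq finite_Diff)
        with D show ?thesis by (simp only: completion_def) simp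
      qed
      then show ?thesis using fin by auto
    qed
    then show ?thesis
      unfolding open_sum_def A_def[symmetric]
      by (simp add: sum.inter_filter[symmetric] finite_partial_derangements fin cong: sum.cong)
  qed
  also have "\<dots> = (\<Sum>\<pi>\<in>derangements n.
      monom (w (inversions (graph_on A \<pi>))) (excedances (graph_on A \<pi>)))"
    unfolding der by (rule sum.reindex_bij_betw[OF bij_betw_graph_on_derangements[OF fin], symmetric])
  also have "\<dots> = (\<Sum>\<pi>\<in>derangements n. monom (w (inv_number n \<pi>)) (exc_number n \<pi>))"
  proof -
    have "excedances (graph_on A \<pi>) = exc_number n \<pi>" for \<pi>
    proof -
      have "{x \<in> graph_on A \<pi>. fst x < snd x} = (\<lambda>i. (i, \<pi> i)) ` {i \<in> A. i < \<pi> i}"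
        by (auto simp: graph_on_def)
      moreover have "inj_on (\<lambda>i. (i, \<pi> i)) S" for S by (simp add: inj_on_def)
      ultimately show ?thesis
        unfolding excedances_def exc_number_def A_def by (simp only: card_image)
    qed
    then show ?thesis by (simp only: A_def inversions_graph_on)
  qed
  finally show ?thesis
    using gamma_cone_open_sum[of n "Suc n" w 0] assms by simp
qed

section \<open>Restriction to one parity\<close>

lemma gamma_cone_exc_gen_poly:
  assumes "stat \<in> {cyc_number n, inv_number n}"
  shows "gamma_cone n (exc_gen_poly n stat {\<pi> \<in> derangements n. evenperm \<pi> = s})"
proof -
  have fin: "finite (derangements n)"
    unfolding derangements_def by (rule finite_subset[OF _ finite_permutations[of "{1..n}"]]) auto
  have nonneg: "nonneg_coeffs (if P then monom 1 k else 0)" for P k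
    by (simp add: nonneg_coeffs_def coeff_monom)
  \<comment> \<open>Permutations of the wrong parity get weight 0, which is non-negative as
    well.\<close>
  have eq: "exc_gen_poly n stat {\<pi> \<in> derangements n. evenperm \<pi> = s} =
      (\<Sum>\<pi>\<in>derangements n. monom (if evenperm \<pi> = s then monom 1 (stat \<pi>) else 0) (exc_number n \<pi>))"
    unfolding exc_gen_poly_def sum.inter_filter[OF fin] by (intro sum.cong) auto
  from assms consider "stat = cyc_number n" | "stat = inv_number n" by blast
  then show ?thesis
  proof cases
    case 1
    have "gamma_cone (card {1..n}) (\<Sum>\<pi>\<in>derangements_on {1..n}.
        monom (if evenperm \<pi> = s then monom 1 (cyc_on {1..n} \<pi>) else 0) (exc_on {1..n} \<pi>))"
      by (rule gamma_cone_cyc[where u = "\<lambda>t k. if t = s then monom 1 k else 0"]) (simp_all add: nonneg)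
    then show ?thesis
      unfolding 1 eq[unfolded 1]
      unfolding derangements_def cyc_number_def exc_number_def derangements_on_def cyc_on_def exc_on_def
      by simp
  next
    case 2
    \<comment> \<open>Unlike the weight for cycles, the weight here has no argument for the sign, so
      the sign is read off the number of inversions.\<close>
    have "evenperm \<pi> \<longleftrightarrow> even (inv_number n \<pi>)" if "\<pi> \<in> derangements n" for \<pi>
      using evenperm_iff_even_inversions[of "{1..n}" \<pi>, unfolded inversions_graph_on] that
      by (simp add: derangements_def)
    then have "exc_gen_poly n stat {\<pi> \<in> derangements n. evenperm \<pi> = s} =
        (\<Sum>\<pi>\<in>derangements n. monom (if even (inv_number n \<pi>) = s then monom 1 (inv_number n \<pi>) else 0)
          (exc_number n \<pi>))"
      unfolding 2 eq[unfolded 2] by (intro sum.cong) auto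
    then show ?thesis
      using gamma_cone_inv[where w = "\<lambda>k. if even k = s then monom 1 k else 0"] nonneg by simp
  qed
qed

theorem theorem4:
  fixes n :: nat and stat :: "(nat \<Rightarrow> nat) \<Rightarrow> nat"
  assumes "n \<ge> 1" and "stat \<in> {cyc_number n, inv_number n}"
  shows "\<exists>b_plus b_minus :: nat \<Rightarrow> int poly.
      (\<forall>i \<le> n div 2. nonneg_coeffs (b_plus i) \<and> nonneg_coeffs (b_minus i)) \<and>
      exc_gen_poly n stat (even_derangements n) = gamma_sum n b_plus \<and>
      exc_gen_poly n stat (odd_derangements n) = gamma_sum n b_minus"
proof -
  have "even_derangements n = {\<pi> \<in> derangements n. evenperm \<pi> = True}"
    "odd_derangements n = {\<pi> \<in> derangements n. evenperm \<pi> = False}"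
    by (auto simp: even_derangements_def odd_derangements_def)
  then show ?thesis
    using gamma_cone_imp_gamma_sum[OF gamma_cone_exc_gen_poly[OF assms(2)], of True]
      gamma_cone_imp_gamma_sum[OF gamma_cone_exc_gen_poly[OF assms(2)], of False]
    by metis
qed

end
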